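(* Let $X$ be a separable Banach space and let $\mu$ be a Borel probability measure on $X$ with a space of admissible shifts $H\subset X$. Suppose that $H$ possesses a dense continuously embedded subspace $(E, \|\cdot\|_E) \subset H$ such that for every $h\in E$ the density of $\mu_h$ with respect to $\mu$ has a continuous representative $\frac{\mathrm{d}\mu_h}{\mathrm{d}\mu} \in C(X)$. Let $\hat x \in X$ be a generalized mode of $\mu$ such that for every $\{\delta_n\}_{n \in \mathbb{N}} \subset (0,\infty)$ with $\delta_n \to 0$ there is an approximating sequence $\{w_n\}_{n \in \mathbb{N}} \subset \hat{x} + E$ (for $\hat x$ and $\{\delta_n\}_{n\in\mathbb{N}}$) with $\|w_n - \hat{x}\|_E \to 0$. If additionally $$\lim_{w \to_{E} \hat x} \frac{\mathrm{d}\mu_{\hat x - w}}{\mathrm{d}\mu}(\hat x) = 1$$ and there is an $r > 0$ such that the family of functions on $X$ $$\left\{ \frac{\mathrm{d}\mu_{\hat x - w}}{\mathrm{d}\mu}: w \in B_E^r(\hat x) \right\}, \qquad B_E^r(\hat x) := \left\{ x \in \hat x + E: \|x - \hat x\|_E < r \right\} \subset \hat x + E,$$ is equicontinuous in $\hat x$, then $\hat x$ is a strong mode of $\mu$.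
   Context: Let $B^\delta(x) \subset X$ denote the open ball of radius $\delta$ around $x$, and for $\delta>0$ let $M^\delta := \sup_{x\in X}\mu(B^\delta(x))$. An element $h\in X$ is an admissible shift of $\mu$ if the shifted measure $\mu_h := \mu(\cdot - h)$ is equivalent to $\mu$ (mutually absolutely continuous). The notation $w\to_E\hat x$ means $w\in\hat x+E$ with $\|w-\hat x\|_E\to0$. A point $\hat x\in X$ is a (strong) mode of $\mu$ if $\lim_{\delta\to 0} \mu(B^\delta(\hat x))/M^\delta = 1$. Given $\hat x\in X$ and a sequence $\{\delta_n\}_{n\in\mathbb{N}}\subset(0,\infty)$ with $\delta_n\to0$, an approximating sequence is a sequence $\{w_n\}_{n\in\mathbb{N}}\subset X$ with $w_n\to\hat x$ in $X$ and $\lim_{n\to\infty}\mu(B^{\delta_n}(w_n))/M^{\delta_n}=1$. The point $\hat x$ is a generalized mode of $\mu$ if for every sequence $\{\delta_n\}_{n\in\mathbb{N}}\subset(0,\infty)$ with $\delta_n\to 0$ such an approximating sequence exists. *)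

theory Defs
  imports "HOL-Probability.Probability"
begin

section \<open>Modes of a measure\<close>

definition max_ball_mass :: "'a::metric_space measure \<Rightarrow> real \<Rightarrow> real" where
  "max_ball_mass \<mu> \<delta> = (SUP x. measure \<mu> (ball x \<delta>))"

definition strong_mode :: "'a::metric_space measure \<Rightarrow> 'a \<Rightarrow> bool" where
  "strong_mode \<mu> x \<longleftrightarrow>
     ((\<lambda>\<delta>. measure \<mu> (ball x \<delta>) / max_ball_mass \<mu> \<delta>) \<longlongrightarrow> 1) (at_right 0)"

definition null_seq :: "(nat \<Rightarrow> real) \<Rightarrow> bool" where
  "null_seq \<delta> \<longleftrightarrow> (\<forall>n. 0 < \<delta> n) \<and> \<delta> \<longlonglongrightarrow> 0"

definition approximating_seq ::
  "'a::metric_space measure \<Rightarrow> 'a \<Rightarrow> (nat \<Rightarrow> real) \<Rightarrow> (nat \<Rightarrow> 'a) \<Rightarrow> bool" where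
  "approximating_seq \<mu> x \<delta> w \<longleftrightarrow>
     w \<longlonglongrightarrow> x \<and>
     (\<lambda>n. measure \<mu> (ball (w n) (\<delta> n)) / max_ball_mass \<mu> (\<delta> n)) \<longlonglongrightarrow> 1"

definition generalized_mode :: "'a::metric_space measure \<Rightarrow> 'a \<Rightarrow> bool" where
  "generalized_mode \<mu> x \<longleftrightarrow> (\<forall>\<delta>. null_seq \<delta> \<longrightarrow> (\<exists>w. approximating_seq \<mu> x \<delta> w))"


section \<open>Shifts and their densities\<close>

text \<open>The image of \<open>\<mu>\<close> under \<open>x \<mapsto> x + h\<close> assigns to \<open>A\<close> the mass \<open>\<mu>(A - h)\<close>.\<close>

definition shift_measure :: "'a::real_normed_vector measure \<Rightarrow> 'a \<Rightarrow> 'a measure" where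
  "shift_measure \<mu> h = distr \<mu> borel (\<lambda>x. x + h)"

definition admissible_shift :: "'a::real_normed_vector measure \<Rightarrow> 'a \<Rightarrow> bool" where
  "admissible_shift \<mu> h \<longleftrightarrow>
     absolutely_continuous \<mu> (shift_measure \<mu> h) \<and>
     absolutely_continuous (shift_measure \<mu> h) \<mu>"

text \<open>A continuous representative is determined only on the support of \<open>\<mu>\<close>, so it is
  a relation between \<open>h\<close> and \<open>f\<close> rather than a function of \<open>h\<close>.\<close>

definition continuous_shift_density ::
  "'a::real_normed_vector measure \<Rightarrow> 'a \<Rightarrow> ('a \<Rightarrow> real) \<Rightarrow> bool" where
  "continuous_shift_density \<mu> h f \<longleftrightarrow>
     continuous_on UNIV f \<and>
     (AE x in \<mu>. f x = enn2real (RN_deriv \<mu> (shift_measure \<mu> h) x))"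


section \<open>Subspaces with a norm of their own\<close>

definition normed_subspace :: "'a::real_vector set \<Rightarrow> ('a \<Rightarrow> real) \<Rightarrow> bool" where
  "normed_subspace E N \<longleftrightarrow>
     subspace E \<and>
     (\<forall>x\<in>E. 0 \<le> N x) \<and>
     (\<forall>x\<in>E. N x = 0 \<longleftrightarrow> x = 0) \<and>
     (\<forall>c. \<forall>x\<in>E. N (c *\<^sub>R x) = \<bar>c\<bar> * N x) \<and>
     (\<forall>x\<in>E. \<forall>y\<in>E. N (x + y) \<le> N x + N y)"

text \<open>\<open>H\<close> carries the norm inherited from the ambient space. Density and continuity of the
  embedding with respect to any finer topology on \<open>H\<close> (such as that of a Cameron-Martin norm)
  imply both properties as stated here.\<close>

definition dense_continuously_embedded ::
  "'a::real_normed_vector set \<Rightarrow> ('a \<Rightarrow> real) \<Rightarrow> 'a set \<Rightarrow> bool" where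
  "dense_continuously_embedded E N H \<longleftrightarrow>
     normed_subspace E N \<and> E \<subseteq> H \<and> H \<subseteq> closure E \<and>
     (\<exists>C. \<forall>x\<in>E. norm x \<le> C * N x)"

definition affine_ball ::
  "'a::real_vector set \<Rightarrow> ('a \<Rightarrow> real) \<Rightarrow> 'a \<Rightarrow> real \<Rightarrow> 'a set" where
  "affine_ball E N x r = {w. w - x \<in> E \<and> N (w - x) < r}"

text \<open>The filter of \<open>w \<rightarrow>\<^sub>E x\<close>, that is \<open>w \<in> x + E\<close> and \<open>N (w - x) \<rightarrow> 0\<close>. The point \<open>w = x\<close>
  is not excluded.\<close>

definition affine_nhds ::
  "'a::real_vector set \<Rightarrow> ('a \<Rightarrow> real) \<Rightarrow> 'a \<Rightarrow> 'a filter" where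
  "affine_nhds E N x =
     inf (filtercomap (\<lambda>w. N (w - x)) (nhds 0)) (principal {w. w - x \<in> E})"

definition equicontinuous_at ::
  "('a::metric_space \<Rightarrow> 'b::metric_space) set \<Rightarrow> 'a \<Rightarrow> bool" where
  "equicontinuous_at F x \<longleftrightarrow>
     (\<forall>\<epsilon>>0. \<exists>\<delta>>0. \<forall>f\<in>F. \<forall>y. dist y x < \<delta> \<longrightarrow> dist (f y) (f x) < \<epsilon>)"

end

theory Submission
  imports Defs
begin

text \<open>
  Translating the ball around \<open>x\<close> by \<open>w - x\<close> turns its mass into the mass of the ball around
  \<open>w\<close>, so \<open>\<mu> (ball w \<delta>)\<close> is the integral over \<open>ball x \<delta>\<close> of the density of the measure shifted
  by \<open>x - w\<close>. If that density is at most \<open>1 + \<epsilon>\<close> on \<open>ball x \<delta>\<close>, then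
  \<open>\<mu> (ball w \<delta>) \<le> (1 + \<epsilon>) * \<mu> (ball x \<delta>)\<close> (lemma \<open>shifted_ball_mass_le\<close>). Along an approximating
  sequence the left-hand side is asymptotically the maximal ball mass, hence the ball around \<open>x\<close>
  captures asymptotically at least the fraction \<open>1 / (1 + \<epsilon>)\<close> of that maximum, and trivially at
  most all of it (lemma \<open>ball_mass_ratio_tendsto_1\<close>).

  The two analytic hypotheses supply the bound on the density: its value at \<open>x\<close> tends to
  \<open>1\<close>, and equicontinuity makes its oscillation over \<open>ball x \<delta>\<close> small uniformly in the shift.
  Uniformity is essential, because the radius and the shift vary together.
\<close>

section \<open>Ball masses relative to the maximal ball mass\<close>

lemma ball_mass_le_max:
  assumes "prob_space \<mu>"
  shows "measure \<mu> (ball x \<delta>) \<le> max_ball_mass \<mu> \<delta>"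
  unfolding max_ball_mass_def
proof (rule cSUP_upper)
  show "bdd_above (range (\<lambda>x. measure \<mu> (ball x \<delta>)))"
    using prob_space.prob_le_1[OF assms] by (intro bdd_aboveI2[where M = 1])
qed simp

lemma ball_mass_ratio_le_1:
  assumes "prob_space \<mu>"
  shows "measure \<mu> (ball x \<delta>) / max_ball_mass \<mu> \<delta> \<le> 1"
proof -
  have "0 \<le> max_ball_mass \<mu> \<delta>"
    using ball_mass_le_max[OF assms, of x \<delta>] measure_nonneg[of \<mu> "ball x \<delta>"] by linarith
  then show ?thesis
    using ball_mass_le_max[OF assms, of x \<delta>] by (auto simp: divide_le_eq_1)
qed

text \<open>A centre whose balls are eventually almost as heavy as the balls along an approximating
  sequence inherits the limit \<open>1\<close>: its ratio lies between the approximating ratio divided by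
  \<open>1 + \<epsilon>\<close> and \<open>1\<close>.\<close>

lemma ball_mass_ratio_tendsto_1:
  assumes "prob_space \<mu>"
    and approx: "(\<lambda>n. measure \<mu> (ball (w n) (\<delta> n)) / max_ball_mass \<mu> (\<delta> n)) \<longlonglongrightarrow> 1"
    and dominated: "\<And>\<epsilon>. 0 < \<epsilon> \<Longrightarrow> \<forall>\<^sub>F n in sequentially.
      measure \<mu> (ball (w n) (\<delta> n)) \<le> (1 + \<epsilon>) * measure \<mu> (ball x (\<delta> n))"
  shows "(\<lambda>n. measure \<mu> (ball x (\<delta> n)) / max_ball_mass \<mu> (\<delta> n)) \<longlonglongrightarrow> 1"
proof (rule order_tendstoI)
  fix a :: real
  assume "1 < a"
  then show "\<forall>\<^sub>F n in sequentially. measure \<mu> (ball x (\<delta> n)) / max_ball_mass \<mu> (\<delta> n) < a"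
    using ball_mass_ratio_le_1[OF assms(1)] le_less_trans by (intro always_eventually) blast
next
  fix a :: real
  assume "a < 1"
  define b where "b = max a 0"
  have b: "0 \<le> b" "b < 1" "a \<le> b" using \<open>a < 1\<close> by (auto simp: b_def)
  \<comment> \<open>Small enough for \<open>b * (1 + \<epsilon>) < 1\<close>: the approximating ratios, which tend to \<open>1\<close>, exceed
    this threshold eventually, and division by \<open>1 + \<epsilon>\<close> leaves more than \<open>b\<close>.\<close>
  define \<epsilon> where "\<epsilon> = (1 - b) / 2"
  have \<epsilon>: "0 < \<epsilon>" using b by (simp add: \<epsilon>_def)
  have "b * (1 + \<epsilon>) < 1"
  proof -
    have "b * \<epsilon> \<le> \<epsilon>" using b \<epsilon> by (simp add: mult_left_le_one_le)
    moreover have "b + \<epsilon> < 1" using b by (simp add: \<epsilon>_def field_simps)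
    ultimately show ?thesis by (simp add: distrib_left)
  qed
  with approx have "\<forall>\<^sub>F n in sequentially.
      b * (1 + \<epsilon>) < measure \<mu> (ball (w n) (\<delta> n)) / max_ball_mass \<mu> (\<delta> n)"
    by (rule order_tendstoD)
  with dominated[OF \<epsilon>]
  show "\<forall>\<^sub>F n in sequentially. a < measure \<mu> (ball x (\<delta> n)) / max_ball_mass \<mu> (\<delta> n)"
  proof eventually_elim
    case (elim n)
    have "0 \<le> max_ball_mass \<mu> (\<delta> n)"
      using ball_mass_le_max[OF assms(1), of x "\<delta> n"] measure_nonneg[of \<mu> "ball x (\<delta> n)"]
      by linarith
    then have "measure \<mu> (ball (w n) (\<delta> n)) / max_ball_mass \<mu> (\<delta> n)
        \<le> (1 + \<epsilon>) * (measure \<mu> (ball x (\<delta> n)) / max_ball_mass \<mu> (\<delta> n))"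
      using divide_right_mono[OF elim(1)] by simp
    then have "(1 + \<epsilon>) * b < (1 + \<epsilon>) * (measure \<mu> (ball x (\<delta> n)) / max_ball_mass \<mu> (\<delta> n))"
      using elim(2) by (simp add: mult.commute)
    then have "b < measure \<mu> (ball x (\<delta> n)) / max_ball_mass \<mu> (\<delta> n)"
      using \<epsilon> by (simp only: mult_less_cancel_left_pos)
    then show ?case using b by linarith
  qed
qed

text \<open>A one-sided limit of a real function is determined by the null sequences approaching from
  that side, so strong modes can be tested along the sequences for which approximating sequences
  are available.\<close>

lemma strong_modeI_sequentially:
  assumes "\<And>\<delta>. null_seq \<delta> \<Longrightarrow>
    (\<lambda>n. measure \<mu> (ball x (\<delta> n)) / max_ball_mass \<mu> (\<delta> n)) \<longlonglongrightarrow> 1"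
  shows "strong_mode \<mu> x"
  unfolding strong_mode_def
  by (rule tendsto_at_right_sequentially[where b = 1]) (auto intro!: assms simp: null_seq_def)

section \<open>Masses of shifted balls\<close>

lemma emeasure_shift_measure_ball:
  fixes \<mu> :: "'a::{real_normed_vector, second_countable_topology} measure"
  assumes "sets \<mu> = sets borel"
  shows "emeasure (shift_measure \<mu> (x - w)) (ball x \<delta>) = emeasure \<mu> (ball w \<delta>)"
proof -
  have "(\<lambda>y. y + (x - w)) \<in> borel_measurable \<mu>"
    by (simp add: measurable_cong_sets[OF assms refl])
  moreover have "space \<mu> = UNIV"
    using sets_eq_imp_space_eq[OF assms] by simp
  moreover have "(\<lambda>y. y + (x - w)) -` ball x \<delta> = ball w \<delta>"
  proof -
    have "x - (y + (x - w)) = w - y" for y by simp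
    then show ?thesis by (auto simp: dist_norm)
  qed
  ultimately show ?thesis
    by (simp add: shift_measure_def emeasure_distr)
qed

text \<open>The representative agrees with the Radon-Nikodym derivative only through
  \<open>enn2real\<close>, which sends \<open>\<infinity>\<close> to \<open>0\<close>. Finiteness of the shifted measure excludes the value
  \<open>\<infinity>\<close> almost everywhere, so no mass is lost.\<close>

lemma emeasure_shift_measure_eq_nn_integral:
  fixes \<mu> :: "'a::{real_normed_vector, second_countable_topology} measure"
  assumes "prob_space \<mu>" and sets: "sets \<mu> = sets borel"
    and "admissible_shift \<mu> h" and dens: "continuous_shift_density \<mu> h f"
    and "A \<in> sets borel"
  shows "emeasure (shift_measure \<mu> h) A = (\<integral>\<^sup>+ y. ennreal (f y) * indicator A y \<partial>\<mu>)"
proof -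
  interpret prob_space \<mu> by fact
  let ?\<nu> = "shift_measure \<mu> h"
  have "(\<lambda>y. y + h) \<in> borel_measurable \<mu>"
    by (simp add: measurable_cong_sets[OF sets refl])
  then interpret \<nu>: prob_space ?\<nu>
    unfolding shift_measure_def by (rule prob_space_distr)
  have ac: "absolutely_continuous \<mu> ?\<nu>"
    using assms(3) by (simp add: admissible_shift_def)
  have sets': "sets ?\<nu> = sets \<mu>"
    by (simp add: shift_measure_def sets)
  have "AE y in \<mu>. RN_deriv \<mu> ?\<nu> y \<noteq> \<infinity>"
    by (rule RN_deriv_finite[OF \<nu>.sigma_finite_measure_axioms ac sets'])
  moreover have "AE y in \<mu>. f y = enn2real (RN_deriv \<mu> ?\<nu> y)"
    using dens by (simp add: continuous_shift_density_def)
  ultimately have eq: "AE y in \<mu>. RN_deriv \<mu> ?\<nu> y = ennreal (f y)"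
    by eventually_elim (simp add: top.not_eq_extremum)
  have "emeasure ?\<nu> A = emeasure (density \<mu> (RN_deriv \<mu> ?\<nu>)) A"
    by (simp add: density_RN_deriv[OF ac sets'])
  also have "\<dots> = (\<integral>\<^sup>+ y. RN_deriv \<mu> ?\<nu> y * indicator A y \<partial>\<mu>)"
    using \<open>A \<in> sets borel\<close> sets by (simp add: emeasure_density)
  also have "\<dots> = (\<integral>\<^sup>+ y. ennreal (f y) * indicator A y \<partial>\<mu>)"
    using eq by (intro nn_integral_cong_AE) (auto elim: eventually_mono)
  finally show ?thesis .
qed

lemma shifted_ball_mass_le:
  fixes \<mu> :: "'a::{real_normed_vector, second_countable_topology} measure"
  assumes "prob_space \<mu>" and sets: "sets \<mu> = sets borel"
    and "admissible_shift \<mu> (x - w)" and "continuous_shift_density \<mu> (x - w) f"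
    and "0 \<le> c" and bound: "\<And>y. y \<in> ball x \<delta> \<Longrightarrow> f y \<le> c"
  shows "measure \<mu> (ball w \<delta>) \<le> c * measure \<mu> (ball x \<delta>)"
proof -
  interpret prob_space \<mu> by fact
  have "emeasure \<mu> (ball w \<delta>) = emeasure (shift_measure \<mu> (x - w)) (ball x \<delta>)"
    by (rule emeasure_shift_measure_ball[OF sets, symmetric])
  also have "\<dots> = (\<integral>\<^sup>+ y. ennreal (f y) * indicator (ball x \<delta>) y \<partial>\<mu>)"
    using assms(1-4) by (rule emeasure_shift_measure_eq_nn_integral) simp
  also have "\<dots> \<le> (\<integral>\<^sup>+ y. ennreal c * indicator (ball x \<delta>) y \<partial>\<mu>)"
  proof (rule nn_integral_mono)
    show "ennreal (f y) * indicator (ball x \<delta>) y \<le> ennreal c * indicator (ball x \<delta>) y" for y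
      using bound[of y] by (auto simp: indicator_def intro: ennreal_leI)
  qed
  also have "\<dots> = ennreal c * emeasure \<mu> (ball x \<delta>)"
    by (rule nn_integral_cmult_indicator) (simp add: sets)
  finally show ?thesis
    using \<open>0 \<le> c\<close> by (simp add: emeasure_eq_measure ennreal_mult[symmetric])
qed

theorem corollary3p9:
  fixes \<mu> :: "'a::{banach, second_countable_topology} measure"
    and H E :: "'a set"
    and normE :: "'a \<Rightarrow> real"
    and dens :: "'a \<Rightarrow> 'a \<Rightarrow> real"
    and xhat :: 'a
    and r :: real
  assumes "prob_space \<mu>" and "sets \<mu> = sets borel"
    and "subspace H" and "\<forall>h\<in>H. admissible_shift \<mu> h"
    and "dense_continuously_embedded E normE H"
    and "\<forall>h\<in>E. continuous_shift_density \<mu> h (dens h)"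
    and "generalized_mode \<mu> xhat"
    and "\<forall>\<delta>. null_seq \<delta> \<longrightarrow>
           (\<exists>w. approximating_seq \<mu> xhat \<delta> w \<and> (\<forall>n. w n - xhat \<in> E) \<and>
                (\<lambda>n. normE (w n - xhat)) \<longlonglongrightarrow> 0)"
    and "((\<lambda>w. dens (xhat - w) xhat) \<longlongrightarrow> 1) (affine_nhds E normE xhat)"
    and "r > 0"
    and "equicontinuous_at {dens (xhat - w) | w. w \<in> affine_ball E normE xhat r} xhat"
  shows "strong_mode \<mu> xhat"
proof (rule strong_modeI_sequentially)
  fix \<delta>
  assume "null_seq \<delta>"
  then have "\<delta> \<longlonglongrightarrow> 0" by (simp add: null_seq_def)
  obtain w where w: "approximating_seq \<mu> xhat \<delta> w" "\<And>n. w n - xhat \<in> E"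
    "(\<lambda>n. normE (w n - xhat)) \<longlonglongrightarrow> 0"
    using assms(8) \<open>null_seq \<delta>\<close> by blast
  have "subspace E" "E \<subseteq> H"
    using assms(5) by (auto simp: dense_continuously_embedded_def normed_subspace_def)
  have shift_in_E: "xhat - w n \<in> E" for n
    using subspace_neg[OF \<open>subspace E\<close> w(2)[of n]] by simp
  have "filterlim w (affine_nhds E normE xhat) sequentially"
    unfolding affine_nhds_def filterlim_inf filterlim_principal filterlim_filtercomap_iff o_def
    using w(2,3) by simp
  then have dens_at_xhat: "(\<lambda>n. dens (xhat - w n) xhat) \<longlonglongrightarrow> 1"
    by (rule filterlim_compose[OF assms(9)])
  show "(\<lambda>n. measure \<mu> (ball xhat (\<delta> n)) / max_ball_mass \<mu> (\<delta> n)) \<longlonglongrightarrow> 1"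
  proof (rule ball_mass_ratio_tendsto_1[OF assms(1), where w = w])
    show "(\<lambda>n. measure \<mu> (ball (w n) (\<delta> n)) / max_ball_mass \<mu> (\<delta> n)) \<longlonglongrightarrow> 1"
      using w(1) by (simp add: approximating_seq_def)
  next
    fix \<epsilon> :: real
    assume "0 < \<epsilon>"
    \<comment> \<open>Half of \<open>\<epsilon>\<close> pays for the value at \<open>xhat\<close>, half for the oscillation over the ball.\<close>
    then have "0 < \<epsilon> / 2" by simp
    then obtain d where "0 < d" and
      d: "\<And>f y. f \<in> {dens (xhat - w) | w. w \<in> affine_ball E normE xhat r} \<Longrightarrow>
        dist y xhat < d \<Longrightarrow> dist (f y) (f xhat) < \<epsilon> / 2"
      using assms(11) unfolding equicontinuous_at_def by meson
    have "\<forall>\<^sub>F n in sequentially. \<delta> n < d"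
      using \<open>\<delta> \<longlonglongrightarrow> 0\<close> \<open>0 < d\<close> by (rule order_tendstoD)
    moreover have "\<forall>\<^sub>F n in sequentially. normE (w n - xhat) < r"
      using w(3) \<open>r > 0\<close> by (rule order_tendstoD)
    moreover have "\<forall>\<^sub>F n in sequentially. dens (xhat - w n) xhat < 1 + \<epsilon> / 2"
      using dens_at_xhat \<open>0 < \<epsilon>\<close> by (intro order_tendstoD) auto
    ultimately show "\<forall>\<^sub>F n in sequentially.
      measure \<mu> (ball (w n) (\<delta> n)) \<le> (1 + \<epsilon>) * measure \<mu> (ball xhat (\<delta> n))"
    proof eventually_elim
      case (elim n)
      have "w n \<in> affine_ball E normE xhat r"
        using w(2) elim(2) by (simp add: affine_ball_def)
      then have mem: "dens (xhat - w n) \<in> {dens (xhat - w) | w. w \<in> affine_ball E normE xhat r}"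
        by blast
      have "dens (xhat - w n) y \<le> 1 + \<epsilon>" if "y \<in> ball xhat (\<delta> n)" for y
      proof -
        have "dist y xhat < d" using that elim(1) by (simp add: dist_commute)
        then have "\<bar>dens (xhat - w n) y - dens (xhat - w n) xhat\<bar> < \<epsilon> / 2"
          using d[OF mem] by (simp add: dist_real_def)
        then show ?thesis using elim(3) by linarith
      qed
      then show ?case
        using assms(1,2,4,6) shift_in_E[of n] \<open>E \<subseteq> H\<close> \<open>0 < \<epsilon>\<close>
        by (intro shifted_ball_mass_le[where f = "dens (xhat - w n)"]) auto
    qed
  qed
qed

end
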